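(* For every positive integer $n\equiv 2\pmod 4$, there exists a near-omniversal Latin square of order $n$.
   Context: A Latin square of order $n$ is an $n\times n$ array on $n$ symbols in which each row and each column contains each symbol exactly once; it is viewed as the set of triples $(r,c,s)$ where $s$ is the symbol in cell $(r,c)$. A partial transversal is a set of triples containing at most one triple in each row, at most one in each column, and at most one with each symbol; its length is its number of triples. It is maximal if it is not contained in a partial transversal of greater length. A Latin square of order $n$ is near-omniversal if, among the integers $\ell$ with $\lceil n/2\rceil\le\ell\le n$, there is exactly one for which it has no maximal partial transversal of length $\ell$. *)

theory Defs
  imports Complex_Main
begin

text \<open>Rows, columns and symbols are all indexed by \<open>{..<n}\<close>; the values of the array
  outside \<open>{..<n} \<times> {..<n}\<close> are irrelevant.\<close>

definition latin_square :: "nat \<Rightarrow> (nat \<Rightarrow> nat \<Rightarrow> nat) \<Rightarrow> bool" where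
  "latin_square n L \<longleftrightarrow>
     (\<forall>r<n. bij_betw (\<lambda>c. L r c) {..<n} {..<n}) \<and>
     (\<forall>c<n. bij_betw (\<lambda>r. L r c) {..<n} {..<n})"

definition triples :: "nat \<Rightarrow> (nat \<Rightarrow> nat \<Rightarrow> nat) \<Rightarrow> (nat \<times> nat \<times> nat) set" where
  "triples n L = {(r, c, s). r < n \<and> c < n \<and> s = L r c}"

definition partial_transversal ::
    "nat \<Rightarrow> (nat \<Rightarrow> nat \<Rightarrow> nat) \<Rightarrow> (nat \<times> nat \<times> nat) set \<Rightarrow> bool" where
  "partial_transversal n L T \<longleftrightarrow>
     T \<subseteq> triples n L \<and>
     inj_on (\<lambda>(r, c, s). r) T \<and> inj_on (\<lambda>(r, c, s). c) T \<and> inj_on (\<lambda>(r, c, s). s) T"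

definition maximal_partial_transversal ::
    "nat \<Rightarrow> (nat \<Rightarrow> nat \<Rightarrow> nat) \<Rightarrow> (nat \<times> nat \<times> nat) set \<Rightarrow> bool" where
  "maximal_partial_transversal n L T \<longleftrightarrow>
     partial_transversal n L T \<and>
     \<not> (\<exists>T'. partial_transversal n L T' \<and> T \<subseteq> T' \<and> card T < card T')"

definition near_omniversal :: "nat \<Rightarrow> (nat \<Rightarrow> nat \<Rightarrow> nat) \<Rightarrow> bool" where
  "near_omniversal n L \<longleftrightarrow>
     (\<exists>!l::nat. \<lceil>real n / 2\<rceil> \<le> int l \<and> l \<le> n \<and>
        \<not> (\<exists>T. maximal_partial_transversal n L T \<and> card T = l))"

end

theory Submission
  imports Defs
begin

text \<open>
  Let \<open>n = 2 * m\<close> with \<open>m\<close> odd. A parity argument shows that a maximal partial transversal of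
  length \<open>m\<close> excludes one of length \<open>n\<close>, so it suffices to find a Latin square with maximal
  partial transversals of all lengths from \<open>m + 1\<close> to \<open>n\<close>.

  Put \<open>m = 2 * M - 1\<close> and \<open>N = 2 * M\<close>. The square contains a cyclic subsquare \<open>Q\<close> of order
  \<open>m - 1 = N - 2\<close>; call its symbols small and the other \<open>N\<close> symbols big. The opposite block \<open>R\<close>
  of order \<open>N\<close> is the table of \<open>c - r\<close> modulo \<open>N\<close> in which the differences \<open>0\<close> and \<open>M\<close> are
  replaced by the big symbols \<open>r\<close> and \<open>r + 1\<close>, and the two remaining blocks contain big symbols
  only. A partial transversal that uses all rows and columns of \<open>R\<close> and all small symbols is
  maximal, since every cell it misses lies in \<open>Q\<close>. An involution of \<open>{0..<N}\<close> whose 2-cycles have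
  the differences \<open>1, \<dots>, M - 1\<close> gives a transversal of \<open>R\<close> with all small symbols and two
  diagonal cells. Replacing \<open>t\<close> of its 2-cycles by diagonal cells, and realising the small symbols
  thus lost by the analogous involution in \<open>Q\<close>, lengthens it by \<open>2 * t\<close>; replacing \<open>a \<le> 2\<close>
  diagonal cells by two cells each in the other two blocks lengthens it by \<open>a\<close>.
\<close>

subsection \<open>Maximal partial transversals and the parity obstruction\<close>

text \<open>By injectivity of the three projections, a triple that a longer transversal adds to
  \<open>T\<close> has a row, a column and a symbol that are all new to \<open>T\<close>.\<close>

lemma maximal_partial_transversalI:
  assumes T: "partial_transversal n L T"
    and covered: "\<And>r c. r < n \<Longrightarrow> c < n \<Longrightarrow> r \<notin> (\<lambda>(r, c, s). r) ` T \<Longrightarrow>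
      c \<notin> (\<lambda>(r, c, s). c) ` T \<Longrightarrow> L r c \<in> (\<lambda>(r, c, s). s) ` T"
  shows "maximal_partial_transversal n L T"
  unfolding maximal_partial_transversal_def
proof (intro conjI notI)
  show "partial_transversal n L T" by (fact T)
next
  assume "\<exists>T'. partial_transversal n L T' \<and> T \<subseteq> T' \<and> card T < card T'"
  then obtain T' where T': "partial_transversal n L T'" "T \<subseteq> T'" "card T < card T'" by blast
  then have "T \<noteq> T'" by auto
  with T' obtain t where t: "t \<in> T'" "t \<notin> T" by blast
  with T' obtain r c where rc: "t = (r, c, L r c)" "r < n" "c < n"
    unfolding partial_transversal_def triples_def by auto
  have new: "f t \<notin> f ` T" if "inj_on f T'" for f :: "_ \<Rightarrow> nat"
    using inj_on_image_mem_iff[OF that t(1) T'(2)] t(2) by simp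
  have "r \<notin> (\<lambda>(r, c, s). r) ` T" "c \<notin> (\<lambda>(r, c, s). c) ` T" "L r c \<notin> (\<lambda>(r, c, s). s) ` T"
    using T'(1) new[of "\<lambda>(r, c, s). r"] new[of "\<lambda>(r, c, s). c"] new[of "\<lambda>(r, c, s). s"]
    unfolding partial_transversal_def rc(1) by simp_all
  with covered rc(2,3) show False by blast
qed

lemma partial_transversal_projections:
  assumes "partial_transversal n L T"
  shows "(\<lambda>(r, c, s). r) ` T \<subseteq> {..<n}" "(\<lambda>(r, c, s). c) ` T \<subseteq> {..<n}"
    "finite T"
    "card ((\<lambda>(r, c, s). r) ` T) = card T" "card ((\<lambda>(r, c, s). c) ` T) = card T"
    "card ((\<lambda>(r, c, s). s) ` T) = card T"
proof -
  show r: "(\<lambda>(r, c, s). r) ` T \<subseteq> {..<n}" and "(\<lambda>(r, c, s). c) ` T \<subseteq> {..<n}"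
    using assms unfolding partial_transversal_def triples_def by auto
  show "finite T"
    using assms finite_subset[OF r] finite_imageD unfolding partial_transversal_def by blast
qed (use assms in \<open>auto simp: partial_transversal_def intro!: card_image\<close>)

lemma maximal_partial_transversalD:
  assumes max: "maximal_partial_transversal n L T"
    and rc: "r < n" "c < n" "r \<notin> (\<lambda>(r, c, s). r) ` T" "c \<notin> (\<lambda>(r, c, s). c) ` T"
  shows "L r c \<in> (\<lambda>(r, c, s). s) ` T"
proof (rule ccontr)
  assume s: "L r c \<notin> (\<lambda>(r, c, s). s) ` T"
  have T: "partial_transversal n L T"
    using max unfolding maximal_partial_transversal_def by blast
  have new: "(r, c, L r c) \<notin> T" using rc(3) by force
  then have "card T < card (insert (r, c, L r c) T)"
    using partial_transversal_projections(3)[OF T] by simp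
  moreover have "partial_transversal n L (insert (r, c, L r c) T)"
    using T rc s new unfolding partial_transversal_def triples_def by simp
  ultimately show False
    using max unfolding maximal_partial_transversal_def by blast
qed

text \<open>The cells missed by a maximal partial transversal of length \<open>m\<close> form a subsquare, so the
  square splits into four subsquares of order \<open>m\<close> and \<open>[r \<in> X] + [c \<in> Y] + [s \<in> Z]\<close> is odd on
  every cell; summing this over a transversal gives \<open>3 * m \<equiv> 2 * m\<close> modulo 2.\<close>

lemma no_half_and_full_length:
  assumes L: "latin_square (2 * m) L" and "odd m"
    and T: "maximal_partial_transversal (2 * m) L T" "card T = m"
    and W: "partial_transversal (2 * m) L W" "card W = 2 * m"
  shows False
proof -
  define X where "X = {..<2 * m} - (\<lambda>(r, c, s). r) ` T"
  define Y where "Y = {..<2 * m} - (\<lambda>(r, c, s). c) ` T"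
  define Z where "Z = (\<lambda>(r, c, s). s) ` T"
  have pT: "partial_transversal (2 * m) L T"
    using T(1) unfolding maximal_partial_transversal_def by blast
  note pTs = partial_transversal_projections[OF pT]
  have card: "card X = m" "card Y = m" "card Z = m"
    using pTs T(2) unfolding X_def Y_def Z_def
    by (auto simp: card_Diff_subset)
  have fin: "finite X" "finite Y" "finite Z"
    using pTs(3) unfolding X_def Y_def Z_def by auto
  have sub: "X \<subseteq> {..<2 * m}" "Y \<subseteq> {..<2 * m}" unfolding X_def Y_def by auto
  have XY: "L r c \<in> Z" if "r \<in> X" "c \<in> Y" for r c
    using maximal_partial_transversalD[OF T(1), of r c] that unfolding X_def Y_def Z_def by blast
  have rowb: "bij_betw (L r) {..<2 * m} {..<2 * m}" if "r < 2 * m" for r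
    using L that unfolding latin_square_def by blast
  have colb: "bij_betw (\<lambda>r. L r c) {..<2 * m} {..<2 * m}" if "c < 2 * m" for c
    using L that unfolding latin_square_def by blast
  \<comment> \<open>An injection from an \<open>m\<close>-set into an \<open>m\<close>-set is onto.
    This is how the missed cells \<open>X \<times> Y\<close> become a subsquare with symbol set
    \<open>Z\<close>.\<close>
  have fills: "f ` A = B"
    if "bij_betw f {..<2 * m} {..<2 * m}" "A \<subseteq> {..<2 * m}" "card A = m" "card B = m" "finite B"
      "\<And>a. a \<in> A \<Longrightarrow> f a \<in> B" for f :: "nat \<Rightarrow> nat" and A B
  proof (rule card_subset_eq)
    show "card (f ` A) = card B"
      using that by (metis bij_betw_imp_inj_on card_image inj_on_subset)
  qed (use that in auto)
  have avoid: "f a \<notin> B"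
    if "bij_betw f {..<2 * m} {..<2 * m}" "A \<subseteq> {..<2 * m}" "f ` A = B"
      "a < 2 * m" "a \<notin> A" for f :: "nat \<Rightarrow> nat" and A B a
    using that inj_on_image_mem_iff[of f "{..<2 * m}" a A] by (auto simp: bij_betw_def)
  have rX: "L r c \<in> Z \<longleftrightarrow> c \<in> Y" if "r \<in> X" "c < 2 * m" for r c
    using XY that avoid[OF rowb sub(2) fills[OF rowb sub(2) card(2,3) fin(3)]] sub by blast
  have cY: "L r c \<in> Z \<longleftrightarrow> r \<in> X" if "c \<in> Y" "r < 2 * m" for r c
  proof -
    have c: "c < 2 * m" using that sub by blast
    show ?thesis
      using XY that avoid[OF colb[OF c] sub(1) fills[OF colb[OF c] sub(1) card(1,3) fin(3)]] by blast
  qed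
  have ZL: "Z \<subseteq> {..<2 * m}"
  proof
    fix z assume "z \<in> Z"
    then obtain r c where "r < 2 * m" "c < 2 * m" "z = L r c"
      using pT unfolding Z_def partial_transversal_def triples_def by auto
    then show "z \<in> {..<2 * m}" using rowb[of r] by (auto simp: bij_betw_def)
  qed
  have rnX: "L r c \<in> Z \<longleftrightarrow> c \<notin> Y" if r: "r < 2 * m" "r \<notin> X" and c: "c < 2 * m" for r c
  proof (cases "c \<in> Y")
    case True
    then show ?thesis using cY r by blast
  next
    case False
    \<comment> \<open>In a row outside \<open>X\<close> the columns of \<open>Y\<close> carry no
      symbol of \<open>Z\<close>, so by counting they use up the complement of \<open>Z\<close> and
      leave \<open>Z\<close> to the other columns.\<close>
    have "L r ` Y = {..<2 * m} - Z"
    proof (rule fills[OF rowb[OF r(1)] sub(2) card(2)])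
      show "card ({..<2 * m} - Z) = m" using ZL card(3) fin by (simp add: card_Diff_subset)
      show "L r y \<in> {..<2 * m} - Z" if "y \<in> Y" for y
        using cY[OF that r(1)] r(2) rowb[OF r(1)] sub that by (auto simp: bij_betw_def)
    qed simp
    from avoid[OF rowb[OF r(1)] sub(2) this c False] show ?thesis
      using False rowb[OF r(1)] c by (auto simp: bij_betw_def)
  qed
  note pWs = partial_transversal_projections[OF W(1)]
  have count: "card {w \<in> W. f w \<in> S} = m"
    if "inj_on f W" "f ` W = {..<2 * m}" "S \<subseteq> {..<2 * m}" "card S = m" for f and S :: "nat set"
  proof -
    have "f ` {w \<in> W. f w \<in> S} = S" using that(2,3) by auto
    moreover have "inj_on f {w \<in> W. f w \<in> S}" using that(1) by (rule inj_on_subset) auto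
    ultimately show ?thesis using card_image that(4) by fastforce
  qed
  have full: "f ` W = {..<2 * m}" if "f ` W \<subseteq> {..<2 * m}" "card (f ` W) = card W" for f
    using that W(2) by (intro card_subset_eq) auto
  have symW: "(\<lambda>(r, c, s). s) ` W \<subseteq> {..<2 * m}"
    using W(1) rowb unfolding partial_transversal_def triples_def bij_betw_def by fastforce
  have injW: "inj_on (\<lambda>(r, c, s). r) W" "inj_on (\<lambda>(r, c, s). c) W" "inj_on (\<lambda>(r, c, s). s) W"
    using W(1) unfolding partial_transversal_def by auto
  define I :: "bool \<Rightarrow> int" where "I = of_bool"
  have sumI: "(\<Sum>w\<in>W. I (f w \<in> S)) = int (card {w \<in> W. f w \<in> S})" for f :: "_ \<Rightarrow> nat" and S
    unfolding I_def using pWs(3) by (simp add: sum.If_cases of_bool_def Int_def)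
  have nr: "(\<Sum>w\<in>W. I ((\<lambda>(r, c, s). r) w \<in> X)) = int m"
    using sumI count[OF injW(1) full[OF pWs(1,4)] sub(1) card(1)] by simp
  have nc: "(\<Sum>w\<in>W. I ((\<lambda>(r, c, s). c) w \<in> Y)) = int m"
    using sumI count[OF injW(2) full[OF pWs(2,5)] sub(2) card(2)] by simp
  have ns: "(\<Sum>w\<in>W. I ((\<lambda>(r, c, s). s) w \<in> Z)) = int m"
    using sumI count[OF injW(3) full[OF symW pWs(6)] ZL card(3)] by simp
  \<comment> \<open>All three memberships hold on cells of \<open>X \<times> Y\<close> and exactly
    one holds elsewhere. The summand 1 turns this odd count into an even one, so that
    \<open>dvd_sum\<close> applies.\<close>
  have "even (I ((\<lambda>(r, c, s). r) w \<in> X) + I ((\<lambda>(r, c, s). c) w \<in> Y) + I ((\<lambda>(r, c, s). s) w \<in> Z) + 1)"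
    if "w \<in> W" for w
  proof -
    have "w \<in> triples (2 * m) L"
      using that W(1) unfolding partial_transversal_def by blast
    then obtain r c where w: "w = (r, c, L r c)" "r < 2 * m" "c < 2 * m"
      unfolding triples_def by auto
    show ?thesis
      using w rX[of r c] rnX[of r c] by (cases "r \<in> X"; cases "c \<in> Y") (auto simp: I_def)
  qed
  then have "even (\<Sum>w\<in>W. I ((\<lambda>(r, c, s). r) w \<in> X) + I ((\<lambda>(r, c, s). c) w \<in> Y)
      + I ((\<lambda>(r, c, s). s) w \<in> Z) + 1)"
    by (rule dvd_sum)
  then have "even (3 * int m + int (card W))"
    unfolding sum.distrib nr nc ns by simp
  with W(2) \<open>odd m\<close> show False by simp
qed

subsection \<open>Relabelling rows, columns and symbols\<close>

text \<open>Sets of cells over arbitrary index types, so that the square can be built from blocks on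
  sum types before it is moved to \<open>{..<n}\<close>.\<close>

definition cell_transversal ::
    "'a set \<Rightarrow> 'b set \<Rightarrow> ('a \<Rightarrow> 'b \<Rightarrow> 'c) \<Rightarrow> ('a \<times> 'b) set \<Rightarrow> bool" where
  "cell_transversal X Y L D \<longleftrightarrow>
     D \<subseteq> X \<times> Y \<and> inj_on fst D \<and> inj_on snd D \<and> inj_on (case_prod L) D"

text \<open>The condition of \<open>maximal_partial_transversalI\<close> for sets of cells.\<close>

definition blocking ::
    "'a set \<Rightarrow> 'b set \<Rightarrow> ('a \<Rightarrow> 'b \<Rightarrow> 'c) \<Rightarrow> ('a \<times> 'b) set \<Rightarrow> bool" where
  "blocking X Y L D \<longleftrightarrow>
     (\<forall>x \<in> X - fst ` D. \<forall>y \<in> Y - snd ` D. L x y \<in> case_prod L ` D)"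

lemma cell_transversal_insert:
  assumes "cell_transversal X Y L D" "x \<in> X" "y \<in> Y"
    and "x \<notin> fst ` D" "y \<notin> snd ` D" "L x y \<notin> case_prod L ` D"
  shows "cell_transversal X Y L (insert (x, y) D)"
  using assms unfolding cell_transversal_def by auto

text \<open>Injectivity of rows and columns suffices because all index sets have the same finite
  size. The quantifier over \<open>D\<close> stands inside, so that a single square
  \<open>L'\<close> serves every length.\<close>

lemma transport_latin_square:
  fixes L :: "'a \<Rightarrow> 'b \<Rightarrow> 'c"
  assumes fin: "finite X" "finite Y" "finite Z" "card X = n" "card Y = n" "card Z = n"
    and rng: "\<And>x y. x \<in> X \<Longrightarrow> y \<in> Y \<Longrightarrow> L x y \<in> Z"
    and row: "\<And>x. x \<in> X \<Longrightarrow> inj_on (L x) Y"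
    and col: "\<And>y. y \<in> Y \<Longrightarrow> inj_on (\<lambda>x. L x y) X"
  shows "\<exists>L'. latin_square n L' \<and> (\<forall>D. cell_transversal X Y L D \<longrightarrow> blocking X Y L D \<longrightarrow>
           (\<exists>T. maximal_partial_transversal n L' T \<and> card T = card D))"
proof -
  obtain \<xi> where \<xi>: "bij_betw \<xi> {..<n} X"
    using fin finite_same_card_bij[of "{..<n}" X] by auto
  obtain \<eta> where \<eta>: "bij_betw \<eta> {..<n} Y"
    using fin finite_same_card_bij[of "{..<n}" Y] by auto
  obtain \<zeta> where \<zeta>: "bij_betw \<zeta> Z {..<n}"
    using fin finite_same_card_bij[of Z "{..<n}"] by auto
  define L' where "L' r c = \<zeta> (L (\<xi> r) (\<eta> c))" for r c
  have mem: "\<xi> r \<in> X" "\<eta> r \<in> Y" if "r < n" for r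
    using \<xi> \<eta> that by (auto simp: bij_betw_def)
  have \<zeta>eq: "\<zeta> a = \<zeta> b \<longleftrightarrow> a = b" if "a \<in> Z" "b \<in> Z" for a b
    using \<zeta> that by (auto simp: bij_betw_def inj_on_def)
  have \<xi>eq: "\<xi> a = \<xi> b \<longleftrightarrow> a = b" if "a < n" "b < n" for a b
    using \<xi> that by (auto simp: bij_betw_def inj_on_def)
  have \<eta>eq: "\<eta> a = \<eta> b \<longleftrightarrow> a = b" if "a < n" "b < n" for a b
    using \<eta> that by (auto simp: bij_betw_def inj_on_def)
  have L'n: "L' r c < n" if "r < n" "c < n" for r c
    using \<zeta> rng mem that unfolding L'_def bij_betw_def by blast
  have bij: "bij_betw f {..<n} {..<n}" if "inj_on f {..<n}" "f ` {..<n} \<subseteq> {..<n}"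
    for f :: "nat \<Rightarrow> nat"
    using endo_inj_surj[OF _ that(2,1)] that(1) by (auto simp: bij_betw_def)
  have "latin_square n L'"
    unfolding latin_square_def
  proof (intro conjI allI impI)
    fix r assume "r < n"
    have "inj_on (L' r) {..<n}"
    proof (rule inj_onI)
      fix a b assume ab: "a \<in> {..<n}" "b \<in> {..<n}" "L' r a = L' r b"
      then have "L (\<xi> r) (\<eta> a) = L (\<xi> r) (\<eta> b)"
        using \<open>r < n\<close> unfolding L'_def by (simp add: \<zeta>eq rng mem)
      with ab show "a = b"
        using inj_onD[OF row[of "\<xi> r"]] mem \<open>r < n\<close> \<eta>eq by blast
    qed
    with L'n \<open>r < n\<close> show "bij_betw (L' r) {..<n} {..<n}" by (intro bij) auto
  next
    fix c assume "c < n"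
    have "inj_on (\<lambda>r. L' r c) {..<n}"
    proof (rule inj_onI)
      fix a b assume ab: "a \<in> {..<n}" "b \<in> {..<n}" "L' a c = L' b c"
      then have "L (\<xi> a) (\<eta> c) = L (\<xi> b) (\<eta> c)"
        using \<open>c < n\<close> unfolding L'_def by (simp add: \<zeta>eq rng mem)
      with ab show "a = b"
        using inj_onD[OF col[of "\<eta> c"]] mem \<open>c < n\<close> \<xi>eq by blast
    qed
    with L'n \<open>c < n\<close> show "bij_betw (\<lambda>r. L' r c) {..<n} {..<n}" by (intro bij) auto
  qed
  moreover have "\<exists>T. maximal_partial_transversal n L' T \<and> card T = card D"
    if D: "cell_transversal X Y L D" and bl: "blocking X Y L D" for D
  proof -
    define T where "T = {(r, c, L' r c) | r c. r < n \<and> c < n \<and> (\<xi> r, \<eta> c) \<in> D}"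
    have D': "D \<subseteq> X \<times> Y" "inj_on fst D" "inj_on snd D" "inj_on (case_prod L) D"
      using D unfolding cell_transversal_def by auto
    have T: "partial_transversal n L' T"
      unfolding partial_transversal_def
    proof (intro conjI)
      show "T \<subseteq> triples n L'" unfolding T_def triples_def by auto
      show "inj_on (\<lambda>(r, c, s). r) T"
        using D'(2) unfolding T_def inj_on_def by (fastforce simp: \<eta>eq)
      show "inj_on (\<lambda>(r, c, s). c) T"
        using D'(3) unfolding T_def inj_on_def by (fastforce simp: \<xi>eq)
      show "inj_on (\<lambda>(r, c, s). s) T"
        using D'(4) unfolding T_def inj_on_def L'_def
        by (fastforce simp: \<zeta>eq \<xi>eq \<eta>eq rng mem)
    qed
    have lift: "\<exists>r c. r < n \<and> c < n \<and> x = \<xi> r \<and> y = \<eta> c \<and> (r, c, L' r c) \<in> T"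
      if xy: "(x, y) \<in> D" for x y
    proof -
      have "x \<in> \<xi> ` {..<n}" "y \<in> \<eta> ` {..<n}" using D'(1) xy \<xi> \<eta> by (auto simp: bij_betw_def)
      then show ?thesis using xy unfolding T_def by auto
    qed
    have "(\<lambda>(r, c, s). (\<xi> r, \<eta> c)) ` T = D"
      using lift by (auto simp: T_def) (force simp: image_iff)
    moreover have "inj_on (\<lambda>(r, c, s). (\<xi> r, \<eta> c)) T"
      unfolding T_def inj_on_def by (auto simp: \<xi>eq \<eta>eq)
    ultimately have "card T = card D" by (metis card_image)
    moreover have "maximal_partial_transversal n L' T"
    proof (rule maximal_partial_transversalI[OF T])
      fix r c
      assume rc: "r < n" "c < n"
        and r: "r \<notin> (\<lambda>(r, c, s). r) ` T" and c: "c \<notin> (\<lambda>(r, c, s). c) ` T"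
      have "\<xi> r \<notin> fst ` D"
      proof
        assume "\<xi> r \<in> fst ` D"
        then obtain y where "(\<xi> r, y) \<in> D" by auto
        from lift[OF this] r \<xi>eq rc show False by force
      qed
      moreover have "\<eta> c \<notin> snd ` D"
      proof
        assume "\<eta> c \<in> snd ` D"
        then obtain x where "(x, \<eta> c) \<in> D" by auto
        from lift[OF this] c \<eta>eq rc show False by force
      qed
      ultimately have "L (\<xi> r) (\<eta> c) \<in> case_prod L ` D"
        using bl mem rc unfolding blocking_def by blast
      then obtain x y where xy: "(x, y) \<in> D" "L (\<xi> r) (\<eta> c) = L x y" by auto
      from lift[OF xy(1)] obtain r' c' where
        "x = \<xi> r'" "y = \<eta> c'" "(r', c', L' r' c') \<in> T" by blast
      with xy(2) show "L' r c \<in> (\<lambda>(r, c, s). s) ` T"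
        unfolding L'_def by force
    qed
    ultimately show ?thesis by blast
  qed
  ultimately show ?thesis by blast
qed

subsection \<open>An involution with distinct displacements\<close>

lemma mod_int_eq_imp_eq:
  fixes a b n :: int
  assumes "a mod n = b mod n" "\<bar>a - b\<bar> < n"
  shows "a = b"
proof (rule ccontr)
  assume "a \<noteq> b"
  moreover have "n dvd \<bar>a - b\<bar>" using assms(1) by (simp add: mod_eq_dvd_iff)
  ultimately show False using zdvd_imp_le[of n "\<bar>a - b\<bar>"] assms(2) by simp
qed

lemma mod_int_wrap:
  fixes x y n :: int
  assumes "x = y \<or> x = y + n \<or> x + n = y" "0 \<le> y" "y < n"
  shows "x mod n = y"
proof -
  have "x mod n = y mod n" using assms(1) mod_add_self2[of x n] by auto
  with assms(2,3) show ?thesis by simp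
qed

text \<open>Used for \<open>\<phi>\<close> and \<open>\<psi>\<close>, of which only two values are
  prescribed; an arbitrary bijection between the remaining elements fills in the rest.\<close>

lemma obtain_injection_two_values:
  assumes "finite A" "finite C" "card A = card C" "a1 \<in> A" "a2 \<in> A" "a1 \<noteq> a2"
    and "c1 \<in> C" "c2 \<in> C" "c1 \<noteq> c2"
  obtains g where "inj_on g A" "g ` A \<subseteq> C" "g a1 = c1" "g a2 = c2"
proof -
  have "card (A - {a1, a2}) = card (C - {c1, c2})"
    using assms by (simp add: card_Diff_subset)
  then obtain f where f: "bij_betw f (A - {a1, a2}) (C - {c1, c2})"
    using assms finite_same_card_bij[of "A - {a1, a2}" "C - {c1, c2}"] by auto
  define g where "g = f(a1 := c1, a2 := c2)"
  have A: "A = insert a1 (insert a2 (A - {a1, a2}))" using assms by auto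
  have on_rest: "g x = f x" if "x \<in> A - {a1, a2}" for x using that by (simp add: g_def)
  have "bij_betw g (A - {a1, a2}) (C - {c1, c2})"
    using f on_rest by (subst bij_betw_cong[of _ g f]) auto
  then have "inj_on g (A - {a1, a2})" "g ` (A - {a1, a2}) = C - {c1, c2}"
    unfolding bij_betw_def by auto
  moreover have "g a1 = c1" "g a2 = c2" using assms by (auto simp: g_def)
  ultimately have "inj_on g (insert a1 (insert a2 (A - {a1, a2})))"
    "g ` insert a1 (insert a2 (A - {a1, a2})) \<subseteq> C"
    using assms by (auto simp: inj_on_insert)
  then have "inj_on g A" "g ` A \<subseteq> C"
    unfolding A[symmetric] by auto
  then show ?thesis using assms by (intro that[of g]) (auto simp: g_def)
qed

text \<open>Reflection of the two consecutive intervals of lengths \<open>2 * (M div 2)\<close> (even) and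
  \<open>2 * M - 1 - 2 * (M div 2)\<close> (odd): the pairs of the first have the odd differences and those of
  the second the even ones.\<close>

definition mirror :: "int \<Rightarrow> int \<Rightarrow> int" where
  "mirror M z = (if z < 2 * (M div 2) then 2 * (M div 2) - 1 - z
     else if z < 2 * M - 1 then 2 * (M div 2) + 2 * M - 2 - z else z)"

text \<open>The two fixed points: the midpoint of the second interval, whose length is odd, and
  below (\<open>fix2\<close>) the point beyond both intervals.\<close>

definition fix1 :: "int \<Rightarrow> int" where "fix1 M = M div 2 + M - 1"
definition fix2 :: "int \<Rightarrow> int" where "fix2 M = 2 * M - 1"

lemma half_bounds: "2 * (M div 2) \<le> M" "M \<le> 2 * (M div 2) + 1" for M :: int
  by presburger+

lemma mirror_range: "z \<in> {0..<2 * M} \<Longrightarrow> mirror M z \<in> {0..<2 * M}"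
  using half_bounds[of M] unfolding mirror_def by auto

lemma mirror_involution: "z \<in> {0..<2 * M} \<Longrightarrow> mirror M (mirror M z) = z"
  using half_bounds[of M] unfolding mirror_def by auto

lemma mirror_fixed: "z \<in> {0..<2 * M} \<Longrightarrow> mirror M z = z \<longleftrightarrow> z = fix1 M \<or> z = fix2 M"
  using half_bounds[of M] unfolding mirror_def fix1_def fix2_def by (simp, presburger)

lemma fix_range:
  assumes "1 \<le> M"
  shows "fix1 M \<in> {0..<2 * M}" "fix2 M \<in> {0..<2 * M}" "fix1 M \<noteq> fix2 M"
  using half_bounds[of M] assms unfolding fix1_def fix2_def by auto

lemma mirror_displacement_le: "z \<in> {0..<2 * M} \<Longrightarrow> \<bar>mirror M z - z\<bar> \<le> M - 1"
  using half_bounds[of M] unfolding mirror_def by auto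

text \<open>The parity of a nonzero displacement tells which interval \<open>z\<close> lies in, and
  there the displacement is a constant minus \<open>2 * z\<close>.\<close>

lemma mirror_displacement_inj:
  assumes "z \<in> {0..<2 * M}" "w \<in> {0..<2 * M}"
    and eq: "mirror M z - z = mirror M w - w" and nz: "mirror M z \<noteq> z"
  shows "z = w"
proof -
  obtain e where e: "M div 2 = e" by simp
  note mir = mirror_def[of M, unfolded e]
  have "odd (mirror M x - x) \<longleftrightarrow> x < 2 * e" for x
    unfolding mir by simp
  then have small: "z < 2 * e \<longleftrightarrow> w < 2 * e"
    using eq by metis
  have "mirror M w \<noteq> w" using eq nz by linarith
  then have "z < 2 * M - 1 \<or> z < 2 * e" "w < 2 * M - 1 \<or> w < 2 * e"
    using nz unfolding mir by presburger+
  then show ?thesis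
    using eq small unfolding mir by (cases "z < 2 * e") simp_all
qed

text \<open>The witnesses solve the two reflection equations for \<open>z\<close>. The interval
  lengths are just large enough for all odd and all even displacements up to
  \<open>M - 1\<close>.\<close>

lemma mirror_displacement_surj:
  assumes "d \<noteq> 0" "\<bar>d\<bar> \<le> M - 1"
  shows "\<exists>z \<in> {0..<2 * M}. mirror M z - z = d"
proof -
  obtain e where e: "M div 2 = e" by simp
  note mir = mirror_def[of M, unfolded e]
  have bounds: "2 * e \<le> M" "M \<le> 2 * e + 1" using half_bounds[of M] unfolding e by auto
  show ?thesis
  proof (cases "odd d")
    case True
    then obtain k where k: "d = 2 * k + 1" by (auto elim: oddE)
    then have "- e \<le> k" "k \<le> e - 1"
      using bounds assms by presburger+
    then show ?thesis
      using k bounds by (intro bexI[of _ "e - 1 - k"]) (simp_all add: mir)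
  next
    case False
    then obtain k where k: "d = 2 * k" by (auto elim: evenE)
    then have "- (M - 1 - e) \<le> k" "k \<le> M - 1 - e" "k \<noteq> 0"
      using bounds assms by presburger+
    then show ?thesis
      using k bounds by (intro bexI[of _ "e + M - 1 - k"]) (simp_all add: mir)
  qed
qed

subsection \<open>The Latin square\<close>

text \<open>In the square below, \<open>f + \<psi> v\<close> and \<open>f + \<phi> u\<close> are the symbols of the cells in row \<open>f\<close>,
  column \<open>v\<close> and in row \<open>u\<close>, column \<open>f\<close> that replace the diagonal cell \<open>(f, f)\<close> of a
  transversal. They have to avoid the symbols of the other diagonal cells in use. The symbols of
  the replaced cells are free, and so are \<open>0\<close> and \<open>2 * (M div 2) - 1\<close>, because this pair is
  always swapped.\<close>

locale construction =
  fixes M :: int and \<phi> \<psi> :: "int \<Rightarrow> int" and u0 :: int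
  assumes M: "2 \<le> M"
    and \<phi>_inj: "inj_on \<phi> {0..<2 * M - 2}"
    and \<phi>_range: "\<phi> ` {0..<2 * M - 2} \<subseteq> {1..<2 * M} - {M + 1}"
    and \<psi>_inj: "inj_on \<psi> {0..<2 * M - 2}"
    and \<psi>_range: "\<psi> ` {0..<2 * M - 2} \<subseteq> {2..<2 * M}"
    and u0: "u0 \<in> {fix1 (M - 1), fix2 (M - 1)}"
    and one_swap: "(fix1 M + \<psi> (fix2 (M - 1))) mod (2 * M) = 2 * (M div 2) - 1"
      "(fix1 M + \<phi> u0) mod (2 * M) = 0"
    and two_swaps:
      "distinct [(fix1 M + \<psi> (fix1 (M - 1))) mod (2 * M), (fix2 M + \<psi> (fix2 (M - 1))) mod (2 * M),
         (fix1 M + \<phi> (fix1 (M - 1))) mod (2 * M), (fix2 M + \<phi> (fix2 (M - 1))) mod (2 * M)]"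
      "{(fix1 M + \<psi> (fix1 (M - 1))) mod (2 * M), (fix2 M + \<psi> (fix2 (M - 1))) mod (2 * M),
         (fix1 M + \<phi> (fix1 (M - 1))) mod (2 * M), (fix2 M + \<phi> (fix2 (M - 1))) mod (2 * M)}
       \<subseteq> {fix1 M, fix2 M, 0, 2 * (M div 2) - 1}"

text \<open>The four prescribed values are solved backwards from the required symbols: the
  replacement cells of \<open>two_swaps\<close> receive exactly \<open>fix1 M\<close>,
  \<open>fix2 M\<close>, 0 and \<open>2 * e - 1\<close>. The flag \<open>swap\<close> exchanges the
  two cells that receive 0 and \<open>fix2 M\<close>.\<close>

lemma construction_exists:
  assumes M: "2 \<le> M"
  shows "\<exists>\<phi> \<psi> u0. construction M \<phi> \<psi> u0"
proof -
  define e where "e = M div 2"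
  have e: "2 * e \<le> M" "M \<le> 2 * e + 1" using half_bounds[of M] unfolding e_def by auto
  then have "1 \<le> e" using M by presburger
  note e = e \<open>1 \<le> e\<close>
  define swap where "swap \<longleftrightarrow> 3 * e = M + 1"
  have M_eq: "M = 3 * e - 1" "e \<le> 2" if swap using that e unfolding swap_def by auto
  \<comment> \<open>The choice without swap needs \<open>M + 1 - e \<noteq> 2 * e\<close>; it fails only for \<open>M = 2\<close> and \<open>M = 5\<close>.\<close>
  define y z where "y = (if swap then M - e else M + 1 - e)" and "z = (if swap then M + 1 - e else M - e)"
  have 1: "fix1 (M - 1) \<in> {0..<2 * M - 2}" "fix2 (M - 1) \<in> {0..<2 * M - 2}" "fix1 (M - 1) \<noteq> fix2 (M - 1)"
    using fix_range[of "M - 1"] M by (auto simp: algebra_simps)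
  have "z \<in> {2..<2 * M}" "M + e \<in> {2..<2 * M}" "z \<noteq> M + e"
    using e M M_eq unfolding z_def swap_def by auto
  moreover have "card {0..<2 * M - 2} = card {2..<2 * M}" using M by simp
  ultimately obtain \<psi> where
    \<psi>: "inj_on \<psi> {0..<2 * M - 2}" "\<psi> ` {0..<2 * M - 2} \<subseteq> {2..<2 * M}"
      "\<psi> (fix1 (M - 1)) = z" "\<psi> (fix2 (M - 1)) = M + e"
    using 1 obtain_injection_two_values[of "{0..<2 * M - 2}" "{2..<2 * M}"
        "fix1 (M - 1)" "fix2 (M - 1)" z "M + e"] by blast
  have "card {0..<2 * M - 2} = card ({1..<2 * M} - {M + 1})"
    using M by (simp add: card_Diff_subset)
  moreover have "y \<in> {1..<2 * M} - {M + 1}" "2 * e \<in> {1..<2 * M} - {M + 1}" "y \<noteq> 2 * e"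
    using e M M_eq unfolding y_def swap_def by auto
  ultimately obtain \<phi> where
    \<phi>: "inj_on \<phi> {0..<2 * M - 2}" "\<phi> ` {0..<2 * M - 2} \<subseteq> {1..<2 * M} - {M + 1}"
      "\<phi> (fix1 (M - 1)) = y" "\<phi> (fix2 (M - 1)) = 2 * e"
    using 1 obtain_injection_two_values[of "{0..<2 * M - 2}" "{1..<2 * M} - {M + 1}"
        "fix1 (M - 1)" "fix2 (M - 1)" y "2 * e"] by blast
  have fM: "fix1 M = e + M - 1" "fix2 M = 2 * M - 1"
    unfolding fix1_def fix2_def e_def by auto
  have distinct: "distinct [fix1 M, fix2 M, 0, 2 * e - 1]"
    unfolding fM using e M by (simp, presburger)
  have vals: "(fix1 M + (M + e)) mod (2 * M) = 2 * e - 1" "(fix2 M + (M + e)) mod (2 * M) = fix1 M"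
    "(fix2 M + 2 * e) mod (2 * M) = 2 * e - 1"
    "(fix1 M + (M + 1 - e)) mod (2 * M) = 0" "(fix1 M + (M - e)) mod (2 * M) = fix2 M"
    unfolding fM by (rule mod_int_wrap; use e in presburger)+
  \<comment> \<open>Here \<open>3 * e = M + 1\<close>, so the value \<open>2 * e\<close> of
    \<open>\<phi>\<close> at \<open>fix2 (M - 1)\<close> already leads to the symbol 0, and
    \<open>u0\<close> can be that row.\<close>
  have swap0: "(fix1 M + 2 * e) mod (2 * M) = 0" if swap
    unfolding fM using M_eq[OF that] M by (auto intro!: mod_int_wrap)
  have "construction M \<phi> \<psi> (if swap then fix2 (M - 1) else fix1 (M - 1))"
  proof (cases swap)
    case True
    then have yz: "y = M - e" "z = M + 1 - e" unfolding y_def z_def by auto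
    show ?thesis
      unfolding construction_def \<phi>(3,4) \<psi>(3,4) yz vals e_def[symmetric]
      using M \<phi>(1,2) \<psi>(1,2) True distinct by (simp add: \<phi>(4) swap0)
  next
    case False
    then have yz: "y = M + 1 - e" "z = M - e" unfolding y_def z_def by auto
    show ?thesis
      unfolding construction_def \<phi>(3,4) \<psi>(3,4) yz vals e_def[symmetric]
      using M \<phi>(1,2) \<psi>(1,2) False distinct by (simp add: \<phi>(3) yz vals)
  qed
  then show ?thesis by blast
qed

text \<open>The differences \<open>1, \<dots>, M - 2\<close> of the quarter square correspond to all differences in
  \<open>1, \<dots>, M - 1\<close> except that of the pair \<open>{0, 2 * (M div 2) - 1}\<close>. For even \<open>M\<close> the exceptional
  difference is \<open>M - 1\<close> and nothing has to be renamed.\<close>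

definition relabel :: "int \<Rightarrow> int \<Rightarrow> int" where
  "relabel M k = (if k = 2 * (M div 2) - 1 then M - 1 else k)"

text \<open>The cyclic square in signed form: residues below \<open>M - 1\<close> are positive
  displacements, those above it negative ones. The residues 0 and \<open>M - 1\<close>, which no
  2-cycle of the quarter involution uses, take the remaining pair of small symbols.\<close>

definition quarter_symbol :: "int \<Rightarrow> int \<Rightarrow> int" where
  "quarter_symbol M e =
     (if e = 0 then 2 * (M div 2) - 1 else if e = M - 1 then 1 - 2 * (M div 2)
      else if e < M - 1 then relabel M e else - relabel M (2 * M - 2 - e))"

text \<open>\<open>Inl\<close> marks rows and columns of the block \<open>R\<close> and the big
  symbols, \<open>Inr\<close> those of \<open>Q\<close> and the small symbols. Small symbols are
  signed representatives of the differences, so that the displacement of an involution is itself the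
  symbol of the cell.\<close>

fun square :: "int \<Rightarrow> (int \<Rightarrow> int) \<Rightarrow> (int \<Rightarrow> int) \<Rightarrow> int + int \<Rightarrow> int + int \<Rightarrow> int + int" where
  "square M \<phi> \<psi> (Inl r) (Inl c) =
     (let d = (c - r) mod (2 * M) in
      if d = 0 then Inl r else if d = M then Inl ((r + 1) mod (2 * M))
      else if d < M then Inr d else Inr (d - 2 * M))"
| "square M \<phi> \<psi> (Inl r) (Inr v) = Inl ((r + \<psi> v) mod (2 * M))"
| "square M \<phi> \<psi> (Inr u) (Inl c) = Inl ((c + \<phi> u) mod (2 * M))"
| "square M \<phi> \<psi> (Inr u) (Inr v) = Inr (quarter_symbol M ((v - u) mod (2 * M - 2)))"

definition lines :: "int \<Rightarrow> (int + int) set" where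
  "lines M = {0..<2 * M} <+> {0..<2 * M - 2}"

definition symbols :: "int \<Rightarrow> (int + int) set" where
  "symbols M = {0..<2 * M} <+> {d. d \<noteq> 0 \<and> \<bar>d\<bar> \<le> M - 1}"

lemma lines_iff [simp]:
  "Inl r \<in> lines M \<longleftrightarrow> r \<in> {0..<2 * M}" "Inr u \<in> lines M \<longleftrightarrow> u \<in> {0..<2 * M - 2}"
  unfolding lines_def by auto

lemma symbols_iff [simp]:
  "Inl s \<in> symbols M \<longleftrightarrow> s \<in> {0..<2 * M}" "Inr d \<in> symbols M \<longleftrightarrow> d \<noteq> 0 \<and> \<bar>d\<bar> \<le> M - 1"
  unfolding symbols_def by auto

section \<open>Cardinalities, and the symbols of the two diagonal blocks\<close>

lemma card_nonzero_interval: "0 \<le> t \<Longrightarrow> card {d :: int. d \<noteq> 0 \<and> \<bar>d\<bar> \<le> t} = nat (2 * t)"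
proof -
  assume "0 \<le> t"
  moreover have "{d :: int. d \<noteq> 0 \<and> \<bar>d\<bar> \<le> t} = {-t..t} - {0}" by auto
  ultimately show ?thesis by (simp add: card_Diff_subset)
qed

lemma finite_nonzero_interval [simp]: "finite {d :: int. d \<noteq> 0 \<and> \<bar>d\<bar> \<le> t}"
  by (rule finite_subset[of _ "{-t..t}"]) auto

lemma card_lines_symbols:
  assumes "1 \<le> M"
  shows "finite (lines M)" "finite (symbols M)"
    "card (lines M) = nat (4 * M - 2)" "card (symbols M) = nat (4 * M - 2)"
proof -
  have "card {d. d \<noteq> 0 \<and> \<bar>d\<bar> \<le> M - 1} = nat (2 * M - 2)"
    using assms card_nonzero_interval[of "M - 1"] by (simp add: algebra_simps)
  with assms show "card (symbols M) = nat (4 * M - 2)"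
    unfolding symbols_def by (simp only: card_Plus finite_nonzero_interval finite_atLeastLessThan_int) simp
  show "finite (symbols M)"
    unfolding symbols_def by (intro finite_Plus finite_nonzero_interval) simp
qed (use assms in \<open>auto simp: lines_def card_Plus\<close>)

lemma quarter_symbol_range:
  assumes "2 \<le> M" "e \<in> {0..<2 * M - 2}"
  shows "quarter_symbol M e \<noteq> 0" "\<bar>quarter_symbol M e\<bar> \<le> M - 1"
proof -
  obtain k where k: "M div 2 = k" by simp
  have "2 * k \<le> M" "M \<le> 2 * k + 1" "2 * k \<noteq> 1"
    using half_bounds[of M] unfolding k by presburger+
  with assms show "quarter_symbol M e \<noteq> 0" "\<bar>quarter_symbol M e\<bar> \<le> M - 1"
    unfolding quarter_symbol_def relabel_def k by auto
qed

text \<open>Avoiding \<open>2 * (M div 2) - 1\<close> is what keeps the pair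
  \<open>{0, 2 * (M div 2) - 1}\<close> swapped for every \<open>t\<close>.\<close>

lemma relabel_range:
  assumes "k \<in> {1..M - 2}"
  shows "relabel M k \<in> {1..M - 1}" "relabel M k \<noteq> 2 * (M div 2) - 1"
proof -
  obtain j where j: "M div 2 = j" by simp
  have "2 * j \<le> M" "M \<le> 2 * j + 1" using half_bounds[of M] unfolding j by auto
  with assms show "relabel M k \<in> {1..M - 1}" "relabel M k \<noteq> 2 * (M div 2) - 1"
    unfolding relabel_def j by auto
qed

lemma quarter_symbol_inj:
  assumes M: "2 \<le> M"
  shows "inj_on (quarter_symbol M) {0..<2 * M - 2}"
proof (rule inj_onI)
  fix a b assume ab: "a \<in> {0..<2 * M - 2}" "b \<in> {0..<2 * M - 2}"
    and eq: "quarter_symbol M a = quarter_symbol M b"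
  obtain k where k: "M div 2 = k" by simp
  have "2 * k \<le> M" "M \<le> 2 * k + 1" "2 * k \<noteq> 1" using half_bounds[of M] unfolding k by presburger+
  with eq ab show "a = b"
    unfolding quarter_symbol_def relabel_def k by (simp split: if_splits)
qed

lemma square_Inl_Inl_eq_Inl:
  assumes "2 \<le> M" "r \<in> {0..<2 * M}" "c \<in> {0..<2 * M}"
  shows "square M \<phi> \<psi> (Inl r) (Inl c) = Inl s \<longleftrightarrow>
    c = r \<and> s = r \<or> (c = r + M \<or> r = c + M) \<and> s = (r + 1) mod (2 * M)"
proof -
  have "(c - r) mod (2 * M) = (if r \<le> c then c - r else c - r + 2 * M)"
    using assms by (intro mod_int_wrap) auto
  then show ?thesis using assms by (auto simp: Let_def split: if_splits)
qed

lemma square_Inl_Inl_eq_Inr: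
  assumes "2 \<le> M" "r \<in> {0..<2 * M}" "c \<in> {0..<2 * M}"
  shows "square M \<phi> \<psi> (Inl r) (Inl c) = Inr s \<longleftrightarrow>
    s \<noteq> 0 \<and> \<bar>s\<bar> \<le> M - 1 \<and> s mod (2 * M) = (c - r) mod (2 * M)"
proof -
  obtain d where d: "(c - r) mod (2 * M) = d" by simp
  then have dr: "0 \<le> d" "d < 2 * M" using assms(1) by auto
  have "s mod (2 * M) = (if 0 \<le> s then s else s + 2 * M)" if "\<bar>s\<bar> \<le> M - 1"
    using that by (intro mod_int_wrap) auto
  then show ?thesis using dr by (auto simp: d Let_def)
qed

section \<open>The Latin property of the square\<close>

context construction
begin

abbreviation "sq \<equiv> square M \<phi> \<psi>"

lemma \<phi>_bounds: "1 \<le> \<phi> u" "\<phi> u < 2 * M" "\<phi> u \<noteq> M + 1" if "u \<in> {0..<2 * M - 2}"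
  using subsetD[OF \<phi>_range imageI[OF that]] by auto

lemma \<psi>_bounds: "2 \<le> \<psi> v" "\<psi> v < 2 * M" if "v \<in> {0..<2 * M - 2}"
  using subsetD[OF \<psi>_range imageI[OF that]] by auto

lemma sq_in_symbols:
  assumes "x \<in> lines M" "y \<in> lines M"
  shows "sq x y \<in> symbols M"
proof (cases x; cases y)
  fix r c assume xy: "x = Inl r" "y = Inl c"
  have rc: "r \<in> {0..<2 * M}" "c \<in> {0..<2 * M}" using assms unfolding xy by auto
  show ?thesis
  proof (cases "sq (Inl r) (Inl c)")
    case (Inl s)
    with square_Inl_Inl_eq_Inl[OF M rc, of \<phi> \<psi> s] rc M show ?thesis
      unfolding xy Inl by auto
  next
    case (Inr s)
    with square_Inl_Inl_eq_Inr[OF M rc, of \<phi> \<psi> s] show ?thesis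
      unfolding xy Inr by simp
  qed
next
  fix u v assume xy: "x = Inr u" "y = Inr v"
  have "(v - u) mod (2 * M - 2) \<in> {0..<2 * M - 2}" using M by simp
  from quarter_symbol_range[OF M this] show ?thesis unfolding xy by simp
qed (use M in auto)

lemma sq_row_inj:
  assumes x: "x \<in> lines M"
  shows "inj_on (sq x) (lines M)"
proof (rule inj_onI)
  fix y y' assume y: "y \<in> lines M" "y' \<in> lines M" and eq: "sq x y = sq x y'"
  show "y = y'"
  proof (cases x)
    case [simp]: (Inl r)
    have r: "r \<in> {0..<2 * M}" using x by simp
    note eqs = square_Inl_Inl_eq_Inl[OF M r] square_Inl_Inl_eq_Inr[OF M r]
    have r1: "(r + 1) mod (2 * M) \<noteq> r mod (2 * M)"
      using mod_int_eq_imp_eq[of "r + 1" "2 * M" r] M by auto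
    have rr: "r mod (2 * M) = r" using r by simp
    \<comment> \<open>Row \<open>r\<close> of \<open>R\<close> carries the big symbols
      \<open>r\<close> and \<open>r + 1\<close>; hence the range of \<open>\<psi>\<close> starts at
      2.\<close>
    have mixed: "sq x (Inl c) \<noteq> sq x (Inr v)" if "c \<in> {0..<2 * M}" "v \<in> {0..<2 * M - 2}" for c v
      using eqs(1)[OF that(1)] \<psi>_bounds[OF that(2)] rr mod_int_eq_imp_eq[of "r + \<psi> v" "2 * M" r]
        mod_int_eq_imp_eq[of "r + \<psi> v" "2 * M" "r + 1"] by auto
    show ?thesis
    proof (cases y; cases y')
      fix c c' assume [simp]: "y = Inl c" "y' = Inl c'"
      have c: "c \<in> {0..<2 * M}" "c' \<in> {0..<2 * M}" using y by auto
      show ?thesis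
      proof (cases "sq x y")
        case (Inl s)
        then have "sq (Inl r) (Inl c) = Inl s" "sq (Inl r) (Inl c') = Inl s" using eq by auto
        then show ?thesis using eqs(1) c r r1 rr by auto
      next
        case (Inr s)
        then have "sq (Inl r) (Inl c) = Inr s" "sq (Inl r) (Inl c') = Inr s" using eq by auto
        then have "(c - r) mod (2 * M) = (c' - r) mod (2 * M)" using eqs(2) c by metis
        with c show ?thesis using mod_int_eq_imp_eq[of "c - r" "2 * M" "c' - r"] by auto
      qed
    next
      fix v v' assume [simp]: "y = Inr v" "y' = Inr v'"
      have v: "v \<in> {0..<2 * M - 2}" "v' \<in> {0..<2 * M - 2}" using y by auto
      have "(r + \<psi> v) mod (2 * M) = (r + \<psi> v') mod (2 * M)" using eq by simp
      then have "\<psi> v = \<psi> v'"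
        using mod_int_eq_imp_eq[of "r + \<psi> v" "2 * M" "r + \<psi> v'"] \<psi>_bounds[OF v(1)] \<psi>_bounds[OF v(2)]
        by auto
      then show ?thesis using inj_onD[OF \<psi>_inj] v by auto
    qed (use mixed eq y in \<open>metis lines_iff\<close>)+
  next
    case [simp]: (Inr u)
    show ?thesis
    proof (cases y; cases y')
      fix c c' assume [simp]: "y = Inl c" "y' = Inl c'"
      show ?thesis
        using eq y mod_int_eq_imp_eq[of "c + \<phi> u" "2 * M" "c' + \<phi> u"] by auto
    next
      fix v v' assume [simp]: "y = Inr v" "y' = Inr v'"
      have "(v - u) mod (2 * M - 2) = (v' - u) mod (2 * M - 2)"
        using inj_onD[OF quarter_symbol_inj[OF M]] eq M by simp
      then show ?thesis
        using y mod_int_eq_imp_eq[of "v - u" "2 * M - 2" "v' - u"] by auto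
    qed (use eq in auto)
  qed
qed

lemma sq_col_inj:
  assumes y: "y \<in> lines M"
  shows "inj_on (\<lambda>x. sq x y) (lines M)"
proof (rule inj_onI)
  fix x x' assume x: "x \<in> lines M" "x' \<in> lines M" and eq: "sq x y = sq x' y"
  show "x = x'"
  proof (cases y)
    case [simp]: (Inl c)
    have c: "c \<in> {0..<2 * M}" using y by simp
    have cc: "c mod (2 * M) = c" using c by simp
    \<comment> \<open>Column \<open>c\<close> of \<open>R\<close> carries the big symbol
      \<open>c\<close> and, from the row at distance \<open>M\<close>, the symbol
      \<open>c + M + 1\<close>; hence \<open>\<phi>\<close> avoids 0 and
      \<open>M + 1\<close>.\<close>
    have half: "(r + 1) mod (2 * M) = (c + M + 1) mod (2 * M)" if "c = r + M \<or> r = c + M" for r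
      using that mod_add_self2[of "r + 1" "2 * M"] by (auto simp: algebra_simps)
    have cM: "(c + M + 1) mod (2 * M) \<noteq> c mod (2 * M)"
      using mod_int_eq_imp_eq[of "c + M + 1" "2 * M" c] M by auto
    have Inl_vals: "s = c \<and> r = c \<or> (c = r + M \<or> r = c + M) \<and> s = (c + M + 1) mod (2 * M)"
      if "r \<in> {0..<2 * M}" "sq (Inl r) y = Inl s" for r s
      using square_Inl_Inl_eq_Inl[OF M that(1) c] that(2) half[of r] by auto
    have mixed: "sq (Inl r) y \<noteq> sq (Inr u) y" if "r \<in> {0..<2 * M}" "u \<in> {0..<2 * M - 2}" for r u
    proof
      assume "sq (Inl r) y = sq (Inr u) y"
      then have "(c + \<phi> u) mod (2 * M) = c mod (2 * M) \<or>
          (c + \<phi> u) mod (2 * M) = (c + M + 1) mod (2 * M)"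
        using Inl_vals[OF that(1)] cc by auto
      moreover have "\<bar>c + \<phi> u - c\<bar> < 2 * M" "\<bar>c + \<phi> u - (c + M + 1)\<bar> < 2 * M"
        using \<phi>_bounds[OF that(2)] M by linarith+
      ultimately have "\<phi> u = 0 \<or> \<phi> u = M + 1"
        using mod_int_eq_imp_eq[of "c + \<phi> u" "2 * M"] by fastforce
      then show False using \<phi>_bounds[OF that(2)] by auto
    qed
    show ?thesis
    proof (cases x; cases x')
      fix r r' assume [simp]: "x = Inl r" "x' = Inl r'"
      have r: "r \<in> {0..<2 * M}" "r' \<in> {0..<2 * M}" using x by auto
      show ?thesis
      proof (cases "sq x y")
        case (Inl s)
        then have "sq (Inl r) y = Inl s" "sq (Inl r') y = Inl s" using eq by auto
        from Inl_vals[OF r(1) this(1)] Inl_vals[OF r(2) this(2)] show ?thesis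
          using r cM cc by auto
      next
        case (Inr s)
        then have "sq (Inl r) (Inl c) = Inr s" "sq (Inl r') (Inl c) = Inr s" using eq by auto
        then have "(c - r) mod (2 * M) = (c - r') mod (2 * M)"
          using square_Inl_Inl_eq_Inr[OF M _ c] r by metis
        with r show ?thesis using mod_int_eq_imp_eq[of "c - r" "2 * M" "c - r'"] by auto
      qed
    next
      fix u u' assume [simp]: "x = Inr u" "x' = Inr u'"
      have u: "u \<in> {0..<2 * M - 2}" "u' \<in> {0..<2 * M - 2}" using x by auto
      have "(c + \<phi> u) mod (2 * M) = (c + \<phi> u') mod (2 * M)" using eq by simp
      then have "\<phi> u = \<phi> u'"
        using mod_int_eq_imp_eq[of "c + \<phi> u" "2 * M" "c + \<phi> u'"] \<phi>_bounds[OF u(1)] \<phi>_bounds[OF u(2)]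
        by auto
      then show ?thesis using inj_onD[OF \<phi>_inj] u by auto
    qed (use mixed eq x in \<open>metis lines_iff\<close>)+
  next
    case [simp]: (Inr v)
    show ?thesis
    proof (cases x; cases x')
      fix r r' assume [simp]: "x = Inl r" "x' = Inl r'"
      show ?thesis
        using eq x mod_int_eq_imp_eq[of "r + \<psi> v" "2 * M" "r' + \<psi> v"] by auto
    next
      fix u u' assume [simp]: "x = Inr u" "x' = Inr u'"
      have "(v - u) mod (2 * M - 2) = (v - u') mod (2 * M - 2)"
        using inj_onD[OF quarter_symbol_inj[OF M]] eq M by simp
      then show ?thesis
        using x mod_int_eq_imp_eq[of "v - u" "2 * M - 2" "v - u'"] by auto
    qed (use eq in auto)
  qed
qed

end

subsection \<open>Blocking transversals of every length\<close>

lemma quarter_symbol_displacement: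
  assumes "2 \<le> M" "d \<noteq> 0" "\<bar>d\<bar> \<le> M - 2"
  shows "quarter_symbol M (d mod (2 * M - 2)) = (if 0 < d then relabel M d else - relabel M (- d))"
proof -
  have "d mod (2 * M - 2) = (if 0 < d then d else d + (2 * M - 2))"
    using assms by (intro mod_int_wrap) auto
  then show ?thesis using assms unfolding quarter_symbol_def by auto
qed

section \<open>The base transversals\<close>

context construction
begin

text \<open>The involution of \<open>R\<close> after its 2-cycles for \<open>t\<close> of the
  differences have been dissolved into fixed points; \<open>quarter_rows\<close> supplies the small
  symbols lost.\<close>

definition core :: "int \<Rightarrow> int \<Rightarrow> int" where
  "core t z = (if \<bar>mirror M z - z\<bar> \<in> relabel M ` {1..t} then z else mirror M z)"

definition quarter_rows :: "int \<Rightarrow> int set" where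
  "quarter_rows t = {z \<in> {0..<2 * M - 2}. mirror (M - 1) z \<noteq> z \<and> \<bar>mirror (M - 1) z - z\<bar> \<le> t}"

text \<open>\<open>F\<close> collects the fixed points whose diagonal cells are left out, to be
  replaced later by cells of the two mixed blocks.\<close>

definition base :: "int \<Rightarrow> int set \<Rightarrow> ((int + int) \<times> (int + int)) set" where
  "base t F = (\<lambda>z. (Inl z, Inl (core t z))) ` ({0..<2 * M} - F)
     \<union> (\<lambda>z. (Inr z, Inr (mirror (M - 1) z))) ` quarter_rows t"

lemma quarter_mirror:
  assumes "z \<in> {0..<2 * M - 2}"
  shows "mirror (M - 1) z \<in> {0..<2 * M - 2}" "mirror (M - 1) (mirror (M - 1) z) = z"
    "\<bar>mirror (M - 1) z - z\<bar> \<le> M - 2"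
  using assms mirror_range[of z "M - 1"] mirror_involution[of z "M - 1"]
    mirror_displacement_le[of z "M - 1"] by (simp_all add: algebra_simps)

lemma quarter_displacement_inj:
  assumes "z \<in> {0..<2 * M - 2}" "w \<in> {0..<2 * M - 2}"
    and "mirror (M - 1) z - z = mirror (M - 1) w - w" "mirror (M - 1) z \<noteq> z"
  shows "z = w"
  using assms mirror_displacement_inj[of z "M - 1" w] by (simp add: algebra_simps)

lemma quarter_rows_finite: "finite (quarter_rows t)"
  by (rule finite_subset[of _ "{0..<2 * M - 2}"]) (auto simp: quarter_rows_def)

lemma quarter_rows_image: "mirror (M - 1) ` quarter_rows t = quarter_rows t"
proof -
  have "mirror (M - 1) z \<in> quarter_rows t" if "z \<in> quarter_rows t" for z
    using that quarter_mirror[of z] unfolding quarter_rows_def by auto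
  moreover have "mirror (M - 1) (mirror (M - 1) z) = z" if "z \<in> quarter_rows t" for z
    using that quarter_mirror[of z] unfolding quarter_rows_def by auto
  ultimately show ?thesis by (metis image_eqI image_subsetI subsetI subset_antisym)
qed

lemma quarter_symbol_cell:
  assumes "z \<in> quarter_rows t" "t \<le> M - 2"
  shows "\<exists>d. sq (Inr z) (Inr (mirror (M - 1) z)) = Inr d \<and> \<bar>d\<bar> \<in> relabel M ` {1..t}"
proof -
  define d where "d = mirror (M - 1) z - z"
  have d: "d \<noteq> 0" "\<bar>d\<bar> \<le> t" using assms(1) unfolding quarter_rows_def d_def by auto
  then have "quarter_symbol M (d mod (2 * M - 2)) = (if 0 < d then relabel M d else - relabel M (- d))"
    using quarter_symbol_displacement[OF M] assms(2) by simp
  moreover have "\<bar>d\<bar> \<in> {1..t}" using d by auto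
  moreover from this have "0 < relabel M \<bar>d\<bar>"
    using relabel_range[of "\<bar>d\<bar>" M] assms(2) by simp
  ultimately show ?thesis
    unfolding d_def by (cases "0 < mirror (M - 1) z - z") (auto simp: image_iff)
qed

text \<open>The displacement maps these rows bijectively onto the nonzero integers of absolute value
  at most \<open>t\<close>.\<close>

lemma card_quarter_rows:
  assumes "0 \<le> t" "t \<le> M - 2"
  shows "card (quarter_rows t) = nat (2 * t)"
proof -
  let ?d = "\<lambda>z. mirror (M - 1) z - z"
  have "inj_on ?d (quarter_rows t)"
    by (rule inj_onI) (use quarter_displacement_inj in \<open>auto simp: quarter_rows_def\<close>)
  moreover have "?d ` quarter_rows t = {d. d \<noteq> 0 \<and> \<bar>d\<bar> \<le> t}"
  proof -
    have "d \<in> ?d ` quarter_rows t" if d: "d \<noteq> 0" "\<bar>d\<bar> \<le> t" for d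
    proof -
      obtain z where "z \<in> {0..<2 * (M - 1)}" "mirror (M - 1) z - z = d"
        using mirror_displacement_surj[of d "M - 1"] d assms(2) by auto
      then show ?thesis
        using d unfolding quarter_rows_def by (intro image_eqI[of _ _ z]) auto
    qed
    then show ?thesis unfolding quarter_rows_def by auto
  qed
  ultimately show ?thesis using card_nonzero_interval[OF assms(1)] card_image by metis
qed

lemma core_props:
  assumes "z \<in> {0..<2 * M}"
  shows "core t z \<in> {0..<2 * M}" "core t (core t z) = z"
  using assms mirror_range[of z M] mirror_involution[of z M] unfolding core_def
  by (auto simp: abs_minus_commute)

lemma core_fix:
  assumes "z \<in> {fix1 M, fix2 M}"
  shows "core t z = z"
  using assms fix_range[of M] mirror_fixed[of z M] M unfolding core_def by auto

text \<open>An involution preserves the complement of a set of its fixed points.\<close>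

lemma core_image:
  assumes "F \<subseteq> {fix1 M, fix2 M}"
  shows "core t ` ({0..<2 * M} - F) = {0..<2 * M} - F"
proof -
  have "core t z \<in> {0..<2 * M} - F" if "z \<in> {0..<2 * M} - F" for z
  proof -
    have "core t z \<notin> F"
    proof
      assume "core t z \<in> F"
      then have "core t (core t z) = core t z" using core_fix assms by blast
      then show False using core_props[of z t] that \<open>core t z \<in> F\<close> by auto
    qed
    then show ?thesis using core_props[of z t] that by auto
  qed
  moreover have "core t (core t z) = z" if "z \<in> {0..<2 * M} - F" for z
    using that core_props by auto
  ultimately show ?thesis by (metis image_eqI image_subsetI subsetI subset_antisym)
qed

lemma core_cell:
  assumes z: "z \<in> {0..<2 * M}"
  shows "sq (Inl z) (Inl (core t z)) = (if core t z = z then Inl z else Inr (mirror M z - z))"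
proof (cases "core t z = z")
  case True
  then show ?thesis by simp
next
  case False
  then have "core t z = mirror M z" "mirror M z \<noteq> z" unfolding core_def by (auto split: if_splits)
  then show ?thesis
    using square_Inl_Inl_eq_Inr[OF M z mirror_range[OF z], of \<phi> \<psi> "mirror M z - z"]
      mirror_displacement_le[OF z] by simp
qed

lemma fst_base: "fst ` base t F = Inl ` ({0..<2 * M} - F) \<union> Inr ` quarter_rows t"
  unfolding base_def by (simp add: image_Un image_image)

lemma snd_base:
  assumes "F \<subseteq> {fix1 M, fix2 M}"
  shows "snd ` base t F = Inl ` ({0..<2 * M} - F) \<union> Inr ` quarter_rows t"
proof -
  have "snd ` base t F = Inl ` core t ` ({0..<2 * M} - F) \<union> Inr ` mirror (M - 1) ` quarter_rows t"
    unfolding base_def by (simp add: image_Un image_image)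
  then show ?thesis by (simp only: core_image[OF assms] quarter_rows_image)
qed

lemma card_base:
  assumes "F \<subseteq> {fix1 M, fix2 M}" "0 \<le> t" "t \<le> M - 2"
  shows "card (base t F) = nat (2 * M + 2 * t) - card F"
proof -
  have "F \<subseteq> {0..<2 * M}" using assms(1) fix_range[of M] M by auto
  moreover from this have "finite F" "card F \<le> nat (2 * M)"
    using finite_subset card_mono[of "{0..<2 * M}" F] by auto
  ultimately have F: "card ({0..<2 * M} - F) = nat (2 * M) - card F" "card F \<le> nat (2 * M)"
    by (auto simp: card_Diff_subset)
  have "card (base t F) = card ({0..<2 * M} - F) + card (quarter_rows t)"
    unfolding base_def
    by (subst card_Un_disjoint) (auto simp: quarter_rows_finite card_image inj_on_def)
  then show ?thesis
    using F card_quarter_rows[OF assms(2,3)] M assms(2) by (simp add: nat_add_distrib)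
qed

text \<open>Big symbols occur only on the remaining diagonal cells, which shows which of them are
  free for new cells.\<close>

lemma base_Inl_symbols:
  assumes "t \<le> M - 2"
  shows "Inl s \<in> case_prod sq ` base t F \<longleftrightarrow> s \<in> {0..<2 * M} - F \<and> core t s = s"
proof
  assume "Inl s \<in> case_prod sq ` base t F"
  then consider z where "z \<in> {0..<2 * M} - F" "Inl s = sq (Inl z) (Inl (core t z))"
    | z where "z \<in> quarter_rows t" "Inl s = sq (Inr z) (Inr (mirror (M - 1) z))"
    unfolding base_def by auto
  then show "s \<in> {0..<2 * M} - F \<and> core t s = s"
  proof cases
    case 1
    then show ?thesis using core_cell[of z t] by (auto split: if_splits)
  qed simp
next
  assume s: "s \<in> {0..<2 * M} - F \<and> core t s = s"
  then have "(Inl s, Inl s) \<in> base t F" unfolding base_def by force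
  moreover have "sq (Inl s) (Inl s) = Inl s" by simp
  ultimately show "Inl s \<in> case_prod sq ` base t F" by (metis case_prod_conv image_eqI)
qed

text \<open>A small symbol is supplied by \<open>Q\<close> if its 2-cycle in \<open>R\<close> was
  dissolved, and by the intact 2-cycle in \<open>R\<close> otherwise.\<close>

lemma base_Inr_symbols:
  assumes t: "t \<le> M - 2" and F: "F \<subseteq> {fix1 M, fix2 M}" and d: "d \<noteq> 0" "\<bar>d\<bar> \<le> M - 1"
  shows "Inr d \<in> case_prod sq ` base t F"
proof (cases "\<bar>d\<bar> \<in> relabel M ` {1..t}")
  case True
  then obtain k where k: "k \<in> {1..t}" "\<bar>d\<bar> = relabel M k" by auto
  define d' where "d' = (if 0 < d then k else - k)"
  have d': "d' \<noteq> 0" "\<bar>d'\<bar> \<le> t" using k unfolding d'_def by auto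
  then obtain z where z: "z \<in> {0..<2 * (M - 1)}" "mirror (M - 1) z - z = d'"
    using mirror_displacement_surj[of d' "M - 1"] t by auto
  then have "z \<in> quarter_rows t" using d' unfolding quarter_rows_def by auto
  then have "(Inr z, Inr (mirror (M - 1) z)) \<in> base t F" unfolding base_def by auto
  moreover have "sq (Inr z) (Inr (mirror (M - 1) z)) = Inr d"
    using quarter_symbol_displacement[OF M d'(1)] d' t k z(2) d unfolding d'_def
    by (auto split: if_splits)
  ultimately show ?thesis by (metis case_prod_conv image_eqI)
next
  case False
  obtain z where z: "z \<in> {0..<2 * M}" "mirror M z - z = d"
    using mirror_displacement_surj[OF d] by auto
  then have "core t z = mirror M z" "core t z \<noteq> z" "z \<notin> F"
    using False d core_fix[of z t] F unfolding core_def by auto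
  then have "(Inl z, Inl (core t z)) \<in> base t F" "sq (Inl z) (Inl (core t z)) = Inr d"
    using z core_cell[OF z(1), of t] unfolding base_def by auto
  then show ?thesis by (metis case_prod_conv image_eqI)
qed

lemma base_cell_transversal:
  assumes t: "t \<le> M - 2" and F: "F \<subseteq> {fix1 M, fix2 M}"
  shows "cell_transversal (lines M) (lines M) sq (base t F)"
  unfolding cell_transversal_def
proof (intro conjI)
  show "base t F \<subseteq> lines M \<times> lines M"
    using core_props quarter_mirror unfolding base_def quarter_rows_def by auto
  show "inj_on fst (base t F)"
    unfolding base_def by (auto simp: inj_on_def)
  have "core t z = core t w \<Longrightarrow> z = w" if "z \<in> {0..<2 * M}" "w \<in> {0..<2 * M}" for z w
    using core_props that by metis
  moreover have "mirror (M - 1) z = mirror (M - 1) w \<Longrightarrow> z = w"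
    if "z \<in> quarter_rows t" "w \<in> quarter_rows t" for z w
    using quarter_mirror that unfolding quarter_rows_def by (metis (lifting) mem_Collect_eq)
  ultimately show "inj_on snd (base t F)"
    unfolding base_def by (auto simp: inj_on_def)
  have RR: "z = w" if "z \<in> {0..<2 * M}" "w \<in> {0..<2 * M}"
    "sq (Inl z) (Inl (core t z)) = sq (Inl w) (Inl (core t w))" for z w
    using that mirror_displacement_inj[of z M w] unfolding core_cell[OF that(1)] core_cell[OF that(2)]
    by (auto simp: core_def split: if_splits)
  have QQ: "z = w" if "z \<in> quarter_rows t" "w \<in> quarter_rows t"
    "sq (Inr z) (Inr (mirror (M - 1) z)) = sq (Inr w) (Inr (mirror (M - 1) w))" for z w
  proof -
    have zw: "z \<in> {0..<2 * M - 2}" "w \<in> {0..<2 * M - 2}" "mirror (M - 1) z \<noteq> z"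
      using that unfolding quarter_rows_def by auto
    have "(mirror (M - 1) z - z) mod (2 * M - 2) = (mirror (M - 1) w - w) mod (2 * M - 2)"
      using inj_onD[OF quarter_symbol_inj[OF M]] that(3) M by simp
    \<comment> \<open>Both displacements are at most \<open>M - 2\<close> in absolute value, so
      congruence modulo \<open>2 * M - 2\<close> forces equality.\<close>
    moreover have "\<bar>(mirror (M - 1) z - z) - (mirror (M - 1) w - w)\<bar> < 2 * M - 2"
      using quarter_mirror(3)[OF zw(1)] quarter_mirror(3)[OF zw(2)] by linarith
    ultimately have "mirror (M - 1) z - z = mirror (M - 1) w - w"
      by (rule mod_int_eq_imp_eq)
    then show ?thesis using quarter_displacement_inj zw by blast
  qed
  have RQ: "sq (Inl z) (Inl (core t z)) \<noteq> sq (Inr w) (Inr (mirror (M - 1) w))"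
    if "z \<in> {0..<2 * M}" "w \<in> quarter_rows t" for z w
    using quarter_symbol_cell[OF that(2) t] core_cell[OF that(1), of t]
    by (auto simp: core_def split: if_splits)
  show "inj_on (case_prod sq) (base t F)"
  proof (rule inj_onI)
    fix p q assume p: "p \<in> base t F" and q: "q \<in> base t F" and eq: "case_prod sq p = case_prod sq q"
    have split: "(\<exists>z \<in> {0..<2 * M}. p = (Inl z, Inl (core t z))) \<or>
      (\<exists>z \<in> quarter_rows t. p = (Inr z, Inr (mirror (M - 1) z)))" if "p \<in> base t F" for p
      using that unfolding base_def by auto
    from split[OF p] split[OF q] show "p = q"
      using eq RR QQ RQ RQ[symmetric] by (elim disjE bexE) (simp_all only: case_prod_conv, blast+)
  qed
qed

section \<open>Blocking, and replacement of diagonal cells\<close>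

lemma not_mem_if_fst_not_mem: "x \<notin> fst ` D \<Longrightarrow> (x, y) \<notin> D"
  by force

text \<open>With all rows and columns of \<open>R\<close> in use, every missed cell lies in
  \<open>Q\<close>, where only small symbols occur.\<close>

lemma blockingI:
  assumes "Inl ` {0..<2 * M} \<subseteq> fst ` D" "Inl ` {0..<2 * M} \<subseteq> snd ` D"
    and "\<And>d. d \<noteq> 0 \<Longrightarrow> \<bar>d\<bar> \<le> M - 1 \<Longrightarrow> Inr d \<in> case_prod sq ` D"
  shows "blocking (lines M) (lines M) sq D"
  unfolding blocking_def
proof (intro ballI)
  fix x y assume x: "x \<in> lines M - fst ` D" and y: "y \<in> lines M - snd ` D"
  have "Inl a \<in> fst ` D" "Inl a \<in> snd ` D" if "a \<in> {0..<2 * M}" for a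
    using assms(1,2) that by blast+
  with x y obtain u v where uv: "x = Inr u" "y = Inr v"
    by (cases x; cases y) auto
  moreover have "sq x y \<in> symbols M" using x y sq_in_symbols by blast
  ultimately have "Inr (quarter_symbol M ((v - u) mod (2 * M - 2))) \<in> symbols M" by simp
  then show "sq x y \<in> case_prod sq ` D"
    using assms(3) unfolding uv by simp
qed

text \<open>These are the two ends of the first interval; their difference is never in the image of
  \<open>relabel\<close>, so their 2-cycle survives and their big symbols stay free.\<close>

lemma core_moves_ends:
  assumes "t \<le> M - 2"
  shows "core t 0 \<noteq> 0" "core t (2 * (M div 2) - 1) \<noteq> 2 * (M div 2) - 1"
proof -
  obtain e where e: "M div 2 = e" by simp
  have "1 \<le> e" using M e by presburger
  moreover have "2 * e - 1 \<notin> relabel M ` {1..t}"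
    using relabel_range(2)[of _ M] assms unfolding e by force
  ultimately show "core t 0 \<noteq> 0" "core t (2 * (M div 2) - 1) \<noteq> 2 * (M div 2) - 1"
    unfolding core_def mirror_def e by auto
qed

text \<open>The fixed points of the quarter involution index rows and columns of \<open>Q\<close>
  that \<open>base\<close> leaves free for every \<open>t\<close>.\<close>

lemma quarter_fix:
  assumes "g \<in> {fix1 (M - 1), fix2 (M - 1)}"
  shows "g \<in> {0..<2 * M - 2}" "g \<notin> quarter_rows t"
  using assms fix_range[of "M - 1"] mirror_fixed[of g "M - 1"] M
  unfolding quarter_rows_def by (auto simp: algebra_simps)

lemma transversal_length_even:
  assumes t: "0 \<le> t" "t \<le> M - 2"
  shows "\<exists>D. cell_transversal (lines M) (lines M) sq D \<and> blocking (lines M) (lines M) sq D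
    \<and> card D = nat (2 * M + 2 * t)"
proof (intro exI conjI)
  show "cell_transversal (lines M) (lines M) sq (base t {})"
    using base_cell_transversal[OF t(2)] by simp
  show "blocking (lines M) (lines M) sq (base t {})"
    using base_Inr_symbols[OF t(2)] by (intro blockingI) (auto simp: fst_base snd_base)
  show "card (base t {}) = nat (2 * M + 2 * t)"
    using card_base[of "{}" t] t by simp
qed

text \<open>The diagonal cell at \<open>fix1 M\<close> gives way to one cell in each mixed block,
  with the free symbols 0 and \<open>2 * (M div 2) - 1\<close>: a net gain of one.\<close>

lemma transversal_length_odd:
  assumes t: "0 \<le> t" "t \<le> M - 2"
  shows "\<exists>D. cell_transversal (lines M) (lines M) sq D \<and> blocking (lines M) (lines M) sq D
    \<and> card D = nat (2 * M + 2 * t + 1)"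
proof -
  define f q g where "f = fix1 M" and "q = 2 * (M div 2) - 1" and "g = fix2 (M - 1)"
  have F: "{f} \<subseteq> {fix1 M, fix2 M}" unfolding f_def by simp
  have f: "f \<in> {0..<2 * M}" using fix_range[of M] M unfolding f_def by auto
  have q: "q \<noteq> 0" unfolding q_def by presburger
  have fixed: "u0 \<in> {0..<2 * M - 2}" "u0 \<notin> quarter_rows t" "g \<in> {0..<2 * M - 2}" "g \<notin> quarter_rows t"
    using quarter_fix u0 unfolding g_def by blast+
  note ends = core_moves_ends[OF t(2), folded q_def]
  have cells: "sq (Inr u0) (Inl f) = Inl 0" "sq (Inl f) (Inr g) = Inl q"
    using one_swap unfolding f_def g_def q_def by simp_all
  define B where "B = base t {f}"
  have B: "cell_transversal (lines M) (lines M) sq B"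
    unfolding B_def by (rule base_cell_transversal[OF t(2) F])
  have Brows: "fst ` B = Inl ` ({0..<2 * M} - {f}) \<union> Inr ` quarter_rows t"
    and Bcols: "snd ` B = Inl ` ({0..<2 * M} - {f}) \<union> Inr ` quarter_rows t"
    unfolding B_def using fst_base snd_base[OF F] by auto
  have Bsyms: "Inl 0 \<notin> case_prod sq ` B" "Inl q \<notin> case_prod sq ` B"
    unfolding B_def base_Inl_symbols[OF t(2)] using ends by auto
  have new: "Inr u0 \<notin> fst ` B" "Inl f \<notin> fst ` B" "Inr g \<notin> snd ` B" "Inl f \<notin> snd ` B"
    using fixed by (auto simp: Brows Bcols)
  define B1 where "B1 = insert (Inr u0, Inl f) B"
  have B1: "cell_transversal (lines M) (lines M) sq B1"
    unfolding B1_def by (rule cell_transversal_insert[OF B]) (use f fixed Bsyms new cells in simp_all)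
  define B2 where "B2 = insert (Inl f, Inr g) B1"
  have B2: "cell_transversal (lines M) (lines M) sq B2"
    unfolding B2_def
    by (rule cell_transversal_insert[OF B1]) (use f fixed Bsyms new cells q in \<open>simp_all add: B1_def\<close>)
  have "(Inr u0, Inl f) \<notin> B" "(Inl f, Inr g) \<notin> B1"
    using new unfolding B1_def by force+
  moreover have "finite B"
    unfolding B_def base_def by (simp add: quarter_rows_finite)
  ultimately have "card B2 = card B + 2" unfolding B2_def B1_def by simp
  then have "card B2 = nat (2 * M + 2 * t + 1)"
    using card_base[OF F t] M t unfolding B_def by simp
  moreover have "blocking (lines M) (lines M) sq B2"
  proof (rule blockingI)
    show "Inl ` {0..<2 * M} \<subseteq> fst ` B2" "Inl ` {0..<2 * M} \<subseteq> snd ` B2"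
      unfolding B2_def B1_def by (auto simp: Brows Bcols)
    show "Inr d \<in> case_prod sq ` B2" if "d \<noteq> 0" "\<bar>d\<bar> \<le> M - 1" for d
      using base_Inr_symbols[OF t(2) F that] unfolding B2_def B1_def B_def by blast
  qed
  ultimately show ?thesis using B2 by blast
qed

text \<open>With \<open>t = M - 2\<close>, both diagonal cells at fixed points give way to four
  cells, which raises the length from \<open>4 * M - 4\<close> to \<open>4 * M - 2\<close>.\<close>

lemma transversal_full_length:
  "\<exists>D. cell_transversal (lines M) (lines M) sq D \<and> blocking (lines M) (lines M) sq D
    \<and> card D = nat (4 * M - 2)"
proof -
  define f1 f2 q g1 g2 t
    where "f1 = fix1 M" and "f2 = fix2 M" and "q = 2 * (M div 2) - 1"
      and "g1 = fix1 (M - 1)" and "g2 = fix2 (M - 1)" and "t = M - 2"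
  note folds = f1_def[symmetric] f2_def[symmetric] q_def[symmetric] g1_def[symmetric] g2_def[symmetric]
  have t: "0 \<le> t" "t \<le> M - 2" using M unfolding t_def by auto
  have F: "{f1, f2} \<subseteq> {fix1 M, fix2 M}" unfolding folds by simp
  have f: "f1 \<in> {0..<2 * M}" "f2 \<in> {0..<2 * M}" "f1 \<noteq> f2"
    using fix_range[of M] M unfolding f1_def f2_def by auto
  have g: "g1 \<in> {0..<2 * M - 2}" "g1 \<notin> quarter_rows t" "g2 \<in> {0..<2 * M - 2}" "g2 \<notin> quarter_rows t"
    using quarter_fix unfolding g1_def g2_def by blast+
  have g12: "g1 \<noteq> g2" using fix_range[of "M - 1"] M unfolding g1_def g2_def by auto
  note ends = core_moves_ends[OF t(2), folded q_def]
  define s1 s2 p1 p2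
    where "s1 = (f1 + \<psi> g1) mod (2 * M)" and "s2 = (f2 + \<psi> g2) mod (2 * M)"
      and "p1 = (f1 + \<phi> g1) mod (2 * M)" and "p2 = (f2 + \<phi> g2) mod (2 * M)"
  note swaps = two_swaps[unfolded folds, folded s1_def s2_def p1_def p2_def]
  have cells: "sq (Inl f1) (Inr g1) = Inl s1" "sq (Inl f2) (Inr g2) = Inl s2"
    "sq (Inr g1) (Inl f1) = Inl p1" "sq (Inr g2) (Inl f2) = Inl p2"
    unfolding s1_def s2_def p1_def p2_def by simp_all
  define B where "B = base t {f1, f2}"
  have B: "cell_transversal (lines M) (lines M) sq B"
    unfolding B_def by (rule base_cell_transversal[OF t(2) F])
  have Brows: "fst ` B = Inl ` ({0..<2 * M} - {f1, f2}) \<union> Inr ` quarter_rows t"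
    and Bcols: "snd ` B = Inl ` ({0..<2 * M} - {f1, f2}) \<union> Inr ` quarter_rows t"
    unfolding B_def using fst_base snd_base[OF F] by auto
  \<comment> \<open>Leaving out the two diagonal cells frees the symbols \<open>f1\<close> and
    \<open>f2\<close>; 0 and \<open>q\<close> are free because their 2-cycle is intact.\<close>
  have free: "Inl s \<notin> case_prod sq ` B" if "s \<in> {f1, f2, 0, q}" for s
    unfolding B_def base_Inl_symbols[OF t(2)] using ends that by blast
  have vals: "s1 \<in> {f1, f2, 0, q}" "s2 \<in> {f1, f2, 0, q}" "p1 \<in> {f1, f2, 0, q}" "p2 \<in> {f1, f2, 0, q}"
    using swaps(2) unfolding insert_subset by blast+
  have Bsyms: "Inl s1 \<notin> case_prod sq ` B" "Inl s2 \<notin> case_prod sq ` B"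
    "Inl p1 \<notin> case_prod sq ` B" "Inl p2 \<notin> case_prod sq ` B"
    by (rule free, rule vals)+
  have distinct: "s1 \<noteq> s2" "s1 \<noteq> p1" "s1 \<noteq> p2" "s2 \<noteq> p1" "s2 \<noteq> p2" "p1 \<noteq> p2"
    using swaps(1) by (simp_all only: distinct.simps list.set insert_iff de_Morgan_disj simp_thms)
  have new: "Inr g1 \<notin> fst ` B" "Inr g2 \<notin> fst ` B" "Inl f1 \<notin> fst ` B" "Inl f2 \<notin> fst ` B"
    "Inr g1 \<notin> snd ` B" "Inr g2 \<notin> snd ` B" "Inl f1 \<notin> snd ` B" "Inl f2 \<notin> snd ` B"
    using g by (auto simp: Brows Bcols)
  have mem: "Inl f1 \<in> lines M" "Inl f2 \<in> lines M" "Inr g1 \<in> lines M" "Inr g2 \<in> lines M"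
    using f g by simp_all
  note facts = mem f(3) g12 Bsyms distinct new cells
  define B1 where "B1 = insert (Inl f1, Inr g1) B"
  have B1: "cell_transversal (lines M) (lines M) sq B1"
    unfolding B1_def by (rule cell_transversal_insert[OF B]) (use facts in \<open>simp_all del: square.simps lines_iff\<close>)
  define B2 where "B2 = insert (Inl f2, Inr g2) B1"
  have B2: "cell_transversal (lines M) (lines M) sq B2"
    unfolding B2_def
    by (rule cell_transversal_insert[OF B1]) (use facts in \<open>simp_all add: B1_def del: square.simps lines_iff\<close>)
  define B3 where "B3 = insert (Inr g1, Inl f1) B2"
  have B3: "cell_transversal (lines M) (lines M) sq B3"
    unfolding B3_def
    by (rule cell_transversal_insert[OF B2]) (use facts in \<open>simp_all add: B2_def B1_def del: square.simps lines_iff\<close>)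
  define B4 where "B4 = insert (Inr g2, Inl f2) B3"
  have B4: "cell_transversal (lines M) (lines M) sq B4"
    unfolding B4_def
    by (rule cell_transversal_insert[OF B3]) (use facts in \<open>simp_all add: B3_def B2_def B1_def del: square.simps lines_iff\<close>)
  have "(Inl f1, Inr g1) \<notin> B" "(Inl f2, Inr g2) \<notin> B1" "(Inr g1, Inl f1) \<notin> B2" "(Inr g2, Inl f2) \<notin> B3"
    using new g12 f(3) by (simp_all add: B1_def B2_def B3_def not_mem_if_fst_not_mem)
  moreover have "finite B"
    unfolding B_def base_def by (simp add: quarter_rows_finite)
  ultimately have "card B4 = card B + 4" unfolding B4_def B3_def B2_def B1_def by simp
  moreover have "card B = nat (4 * M - 4) - 2"
  proof -
    have "2 * M + 2 * t = 4 * M - 4" "card {f1, f2} = 2" using f(3) unfolding t_def by simp_all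
    then show ?thesis using card_base[OF F t] unfolding B_def by simp
  qed
  ultimately have "card B4 = nat (4 * M - 2)" using M by simp
  moreover have "blocking (lines M) (lines M) sq B4"
  proof (rule blockingI)
    show "Inl ` {0..<2 * M} \<subseteq> fst ` B4" "Inl ` {0..<2 * M} \<subseteq> snd ` B4"
      unfolding B4_def B3_def B2_def B1_def image_insert fst_conv snd_conv Brows Bcols by blast+
    show "Inr d \<in> case_prod sq ` B4" if "d \<noteq> 0" "\<bar>d\<bar> \<le> M - 1" for d
      using base_Inr_symbols[OF t(2) F that] unfolding B4_def B3_def B2_def B1_def B_def by blast
  qed
  ultimately show ?thesis using B4 by blast
qed

lemma transversal_all_lengths:
  assumes "2 * M \<le> l" "l \<le> 4 * M - 2"
  shows "\<exists>D. cell_transversal (lines M) (lines M) sq D \<and> blocking (lines M) (lines M) sq D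
    \<and> card D = nat l"
proof (cases "l = 4 * M - 2")
  case True
  then show ?thesis using transversal_full_length by simp
next
  case False
  \<comment> \<open>The even and odd lengths with \<open>t \<le> M - 2\<close> reach exactly
    \<open>4 * M - 3\<close>, which is why the full length was split off.\<close>
  define t where "t = (l - 2 * M) div 2"
  have "0 \<le> t" "t \<le> M - 2" "l = 2 * M + 2 * t \<or> l = 2 * M + 2 * t + 1"
    using assms False unfolding t_def by presburger+
  then show ?thesis
    using transversal_length_even[of t] transversal_length_odd[of t] by auto
qed

end

section \<open>Near-omniversality, and the exceptional order 2\<close>

lemma near_omniversalI:
  assumes L: "latin_square (2 * m) L" and m: "odd m"
    and long: "\<And>l. m < l \<Longrightarrow> l \<le> 2 * m \<Longrightarrow> \<exists>T. maximal_partial_transversal (2 * m) L T \<and> card T = l"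
  shows "near_omniversal (2 * m) L"
proof -
  have "0 < m" using m by (rule odd_pos)
  then obtain W where "maximal_partial_transversal (2 * m) L W" "card W = 2 * m"
    using long[of "2 * m"] by auto
  \<comment> \<open>The full-length transversal excludes length \<open>m\<close>, the lower end of
    the range, which is thus the only missing length.\<close>
  then have "\<not> (\<exists>T. maximal_partial_transversal (2 * m) L T \<and> card T = m)"
    using no_half_and_full_length[OF L m] unfolding maximal_partial_transversal_def by blast
  then show ?thesis
    unfolding near_omniversal_def using long by (intro ex1I[of _ m]) (auto simp: le_less)
qed

text \<open>Order 2 would need \<open>M = 1\<close>, which the construction excludes. In the cyclic
  square the missing length is the full one: a single cell is already maximal, so the parity
  obstruction forbids length 2.\<close>

lemma near_omniversal_two: "\<exists>L. latin_square 2 L \<and> near_omniversal 2 L"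
proof -
  define L :: "nat \<Rightarrow> nat \<Rightarrow> nat" where "L r c = (r + c) mod 2" for r c
  have two: "{..<2 :: nat} = {0, 1}" by auto
  have L: "latin_square 2 L"
    unfolding latin_square_def two bij_betw_def inj_on_def L_def
    by (auto simp: less_Suc_eq numeral_2_eq_2)
  have T: "maximal_partial_transversal 2 L {(0, 0, 0)}"
    by (rule maximal_partial_transversalI)
      (auto simp: partial_transversal_def triples_def L_def less_Suc_eq numeral_2_eq_2)
  have "\<not> (\<exists>T. maximal_partial_transversal 2 L T \<and> card T = 2)"
    using no_half_and_full_length[of 1 L "{(0, 0, 0)}"] L T unfolding maximal_partial_transversal_def by auto
  moreover have "card {(0 :: nat, 0 :: nat, 0 :: nat)} = 1" by simp
  ultimately have "near_omniversal 2 L"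
    unfolding near_omniversal_def using T
    by (intro ex1I[of _ 2]) (auto simp: le_Suc_eq numeral_2_eq_2)
  with L show ?thesis by blast
qed

theorem theorem1p4:
  fixes n :: nat
  assumes "n > 0" and "n mod 4 = 2"
  shows "\<exists>L. latin_square n L \<and> near_omniversal n L"
proof (cases "n = 2")
  case True
  then show ?thesis using near_omniversal_two by simp
next
  case False
  \<comment> \<open>Chosen so that \<open>m = 2 * M - 1\<close>; then \<open>n = 4 * M - 2\<close>
    is the number of elements of \<open>lines M\<close>, and \<open>n \<noteq> 2\<close> gives
    \<open>M \<ge> 2\<close>.\<close>
  define m M where "m = n div 2" and "M = (int m + 1) div 2"
  have m: "n = 2 * m" "odd m" using assms(2) unfolding m_def by presburger+
  then have mM: "int m = 2 * M - 1" "2 \<le> M"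
    using False unfolding M_def by presburger+
  obtain \<phi> \<psi> u0 where "construction M \<phi> \<psi> u0" using construction_exists[OF mM(2)] by blast
  then interpret construction M \<phi> \<psi> u0 .
  have "4 * M - 2 = int n" using m(1) mM(1) by linarith
  then have "nat (4 * M - 2) = n" by simp
  then obtain L where L: "latin_square n L"
    and T: "\<And>D. cell_transversal (lines M) (lines M) sq D \<Longrightarrow> blocking (lines M) (lines M) sq D \<Longrightarrow>
      \<exists>T. maximal_partial_transversal n L T \<and> card T = card D"
    using transport_latin_square[of "lines M" "lines M" "symbols M" n sq]
      card_lines_symbols[of M] mM sq_in_symbols sq_row_inj sq_col_inj by auto
  have "\<exists>T. maximal_partial_transversal n L T \<and> card T = l" if "m < l" "l \<le> 2 * m" for l
  proof -
    have "2 * M \<le> int l" "int l \<le> 4 * M - 2" using that mM by linarith+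
    from transversal_all_lengths[OF this] obtain D where
      "cell_transversal (lines M) (lines M) sq D" "blocking (lines M) (lines M) sq D" "card D = l"
      by auto
    with T show ?thesis by metis
  qed
  with L m show ?thesis using near_omniversalI by blast
qed

end
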